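(* Let $(X,\lambda)$ and $(Y,\lambda')$ be two asymptotically equivalent AS.R. spaces. Then $\operatorname{lsInd}_{\lambda}X=\operatorname{lsInd}_{\lambda'}Y$.
   Context: An asymptotic resemblance (AS.R.) $\lambda$ on a set $X$ is an equivalence relation on the family of all subsets of $X$ such that: (i) $A_1\lambda B_1$ and $A_2\lambda B_2$ imply $(A_1\cup A_2)\lambda(B_1\cup B_2)$; (ii) if $(B_1\cup B_2)\lambda A$ with $B_1,B_2\ne\emptyset$, then there are nonempty $A_1,A_2\subseteq A$ with $A=A_1\cup A_2$ and $B_i\lambda A_i$ for $i=1,2$. The pair $(X,\lambda)$ is an AS.R. space. A subset $A\subseteq X$ is bounded if $A=\emptyset$ or $A\lambda\{x\}$ for some $x\in X$. For $C\subseteq X$, $\lambda_C$ denotes the restriction of $\lambda$ to subsets of $C$; $(C,\lambda_C)$ is an AS.R. space. An AS.R. mapping $f:(X,\lambda)\to(Y,\lambda')$ is a map such that $f^{-1}(B)$ is bounded for every bounded $B\subseteq Y$, and $A\lambda B$ implies $f(A)\lambda' f(B)$ for all $A,B\subseteq X$. The spaces $(X,\lambda)$ and $(Y,\lambda')$ are asymptotically equivalent if there are AS.R. mappings $f:X\to Y$ and $g:Y\to X$ with $g(f(A))\lambda A$ for all $A\subseteq X$ and $f(g(B))\lambda' B$ for all $B\subseteq Y$. Subsets $A,B\subseteq X$ are asymptotically disjoint if there are no unbounded $L_1\subseteq A$, $L_2\subseteq B$ with $L_1\lambda L_2$. For asymptotically disjoint $A,B\subseteq X$, a set $C\subseteq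 X$ is a large scale separator between $A$ and $B$ if (i) $C$ is asymptotically disjoint from $A$ and from $B$; (ii) $X=X_1\cup X_2$ for some $X_1,X_2$ with $X_1$ asymptotically disjoint from $A$ and $X_2$ asymptotically disjoint from $B$, such that whenever $L_1\subseteq X_1$, $L_2\subseteq X_2$ are unbounded and $L_1\lambda L_2$, there is $L\subseteq C$ with $L\lambda L_1$. The large scale inductive dimension is defined inductively: $\operatorname{lsInd}_\lambda X=-1$ if and only if $X$ is bounded (in particular this holds for the empty set); for $n\in\{0,1,2,\dots\}$, $\operatorname{lsInd}_\lambda X\le n$ if for every two asymptotically disjoint $A,B\subseteq X$ there is a large scale separator $C$ between them with $\operatorname{lsInd}_{\lambda_C}C\le n-1$. $\operatorname{lsInd}_\lambda X=n$ if it is $\le n$ but not $\le n-1$, and it is infinite if it is $\le n$ for no $n$. *)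

theory Defs
  imports Main "HOL-Library.Extended" "HOL-Library.FuncSet"
begin

definition asr_space :: "'a set \<Rightarrow> ('a set \<times> 'a set) set \<Rightarrow> bool" where
  "asr_space X lam \<longleftrightarrow>
     equiv (Pow X) lam \<and>
     (\<forall>A1 B1 A2 B2. (A1, B1) \<in> lam \<longrightarrow> (A2, B2) \<in> lam \<longrightarrow> (A1 \<union> A2, B1 \<union> B2) \<in> lam) \<and>
     (\<forall>B1 B2 A. (B1 \<union> B2, A) \<in> lam \<longrightarrow> B1 \<noteq> {} \<longrightarrow> B2 \<noteq> {} \<longrightarrow>
        (\<exists>A1 A2. A1 \<noteq> {} \<and> A2 \<noteq> {} \<and> A1 \<subseteq> A \<and> A2 \<subseteq> A \<and> A = A1 \<union> A2 \<and>
                 (B1, A1) \<in> lam \<and> (B2, A2) \<in> lam))"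

definition asr_bounded :: "'a set \<Rightarrow> ('a set \<times> 'a set) set \<Rightarrow> 'a set \<Rightarrow> bool" where
  "asr_bounded X lam A \<longleftrightarrow> A \<subseteq> X \<and> (A = {} \<or> (\<exists>x\<in>X. (A, {x}) \<in> lam))"

definition asr_restrict :: "('a set \<times> 'a set) set \<Rightarrow> 'a set \<Rightarrow> ('a set \<times> 'a set) set" where
  "asr_restrict lam C = lam \<inter> (Pow C \<times> Pow C)"

definition asr_mapping ::
  "'a set \<Rightarrow> ('a set \<times> 'a set) set \<Rightarrow> 'b set \<Rightarrow> ('b set \<times> 'b set) set \<Rightarrow> ('a \<Rightarrow> 'b) \<Rightarrow> bool" where
  "asr_mapping X lam Y lam' f \<longleftrightarrow>
     f \<in> X \<rightarrow> Y \<and>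
     (\<forall>B. B \<subseteq> Y \<longrightarrow> asr_bounded Y lam' B \<longrightarrow> asr_bounded X lam (f -` B \<inter> X)) \<and>
     (\<forall>A B. A \<subseteq> X \<longrightarrow> B \<subseteq> X \<longrightarrow> (A, B) \<in> lam \<longrightarrow> (f ` A, f ` B) \<in> lam')"

definition asymptotically_equivalent ::
  "'a set \<Rightarrow> ('a set \<times> 'a set) set \<Rightarrow> 'b set \<Rightarrow> ('b set \<times> 'b set) set \<Rightarrow> bool" where
  "asymptotically_equivalent X lam Y lam' \<longleftrightarrow>
     (\<exists>f g. asr_mapping X lam Y lam' f \<and> asr_mapping Y lam' X lam g \<and>
        (\<forall>A. A \<subseteq> X \<longrightarrow> (g ` (f ` A), A) \<in> lam) \<and>
        (\<forall>B. B \<subseteq> Y \<longrightarrow> (f ` (g ` B), B) \<in> lam'))"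

definition asymptotically_disjoint ::
  "'a set \<Rightarrow> ('a set \<times> 'a set) set \<Rightarrow> 'a set \<Rightarrow> 'a set \<Rightarrow> bool" where
  "asymptotically_disjoint X lam A B \<longleftrightarrow>
     A \<subseteq> X \<and> B \<subseteq> X \<and>
     \<not> (\<exists>L1 L2. L1 \<subseteq> A \<and> L2 \<subseteq> B \<and> \<not> asr_bounded X lam L1 \<and> \<not> asr_bounded X lam L2 \<and>
               (L1, L2) \<in> lam)"

definition large_scale_separator ::
  "'a set \<Rightarrow> ('a set \<times> 'a set) set \<Rightarrow> 'a set \<Rightarrow> 'a set \<Rightarrow> 'a set \<Rightarrow> bool" where
  "large_scale_separator X lam A B C \<longleftrightarrow>
     C \<subseteq> X \<and> asymptotically_disjoint X lam C A \<and> asymptotically_disjoint X lam C B \<and>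
     (\<exists>X1 X2. X = X1 \<union> X2 \<and>
        asymptotically_disjoint X lam X1 A \<and> asymptotically_disjoint X lam X2 B \<and>
        (\<forall>L1 L2. L1 \<subseteq> X1 \<longrightarrow> L2 \<subseteq> X2 \<longrightarrow>
           \<not> asr_bounded X lam L1 \<longrightarrow> \<not> asr_bounded X lam L2 \<longrightarrow> (L1, L2) \<in> lam \<longrightarrow>
           (\<exists>L\<subseteq>C. (L, L1) \<in> lam)))"

inductive lsInd_le :: "'a set \<Rightarrow> ('a set \<times> 'a set) set \<Rightarrow> int \<Rightarrow> bool" where
  bounded: "asr_bounded X lam X \<Longrightarrow> lsInd_le X lam (-1)"
| step: "\<lbrakk>n \<ge> 0;
    \<forall>A B. asymptotically_disjoint X lam A B \<longrightarrow>
      (\<exists>C. large_scale_separator X lam A B C \<and> lsInd_le C (asr_restrict lam C) (n - 1))\<rbrakk>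
    \<Longrightarrow> lsInd_le X lam n"

text \<open>The description in the first branch is justified by monotonicity of \<open>lsInd_le\<close> in its
  last argument; see \<open>lsInd_eq_Fin_iff\<close> below.\<close>

definition lsInd :: "'a set \<Rightarrow> ('a set \<times> 'a set) set \<Rightarrow> int extended" where
  "lsInd X lam =
     (if \<exists>n. lsInd_le X lam n then Fin (THE n. lsInd_le X lam n \<and> \<not> lsInd_le X lam (n - 1))
      else Pinf)"

lemma asr_space_restrict:
  assumes "asr_space X lam" "C \<subseteq> X"
  shows "asr_space C (asr_restrict lam C)"
proof -
  have eq: "equiv (Pow X) lam"
    and un: "\<And>A1 B1 A2 B2. (A1, B1) \<in> lam \<Longrightarrow> (A2, B2) \<in> lam \<Longrightarrow> (A1 \<union> A2, B1 \<union> B2) \<in> lam"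
    and sp: "\<And>B1 B2 A. (B1 \<union> B2, A) \<in> lam \<Longrightarrow> B1 \<noteq> {} \<Longrightarrow> B2 \<noteq> {} \<Longrightarrow>
        \<exists>A1 A2. A1 \<noteq> {} \<and> A2 \<noteq> {} \<and> A1 \<subseteq> A \<and> A2 \<subseteq> A \<and> A = A1 \<union> A2 \<and>
                 (B1, A1) \<in> lam \<and> (B2, A2) \<in> lam"
    using assms(1) unfolding asr_space_def by simp_all
  have "equiv (Pow C) (asr_restrict lam C)"
  proof (rule equivI)
    show "refl_on (Pow C) (asr_restrict lam C)"
      using eq assms(2) by (auto simp: equiv_def asr_restrict_def refl_on_def)
    show "sym (asr_restrict lam C)"
      using eq by (auto simp: equiv_def asr_restrict_def sym_def)
    show "trans (asr_restrict lam C)"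
      using eq unfolding equiv_def asr_restrict_def trans_def by blast
  qed (auto simp: asr_restrict_def)
  moreover have "\<exists>A1 A2. A1 \<noteq> {} \<and> A2 \<noteq> {} \<and> A1 \<subseteq> A \<and> A2 \<subseteq> A \<and> A = A1 \<union> A2 \<and>
                 (B1, A1) \<in> asr_restrict lam C \<and> (B2, A2) \<in> asr_restrict lam C"
    if h: "(B1 \<union> B2, A) \<in> asr_restrict lam C" "B1 \<noteq> {}" "B2 \<noteq> {}" for B1 B2 A
  proof -
    have "(B1 \<union> B2, A) \<in> lam" "B1 \<subseteq> C" "B2 \<subseteq> C" "A \<subseteq> C"
      using h(1) by (auto simp: asr_restrict_def)
    with sp[of B1 B2 A] h(2,3) obtain A1 A2 where
      "A1 \<noteq> {}" "A2 \<noteq> {}" "A1 \<subseteq> A" "A2 \<subseteq> A" "A = A1 \<union> A2" "(B1, A1) \<in> lam" "(B2, A2) \<in> lam"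
      by blast
    then show ?thesis
      using \<open>B1 \<subseteq> C\<close> \<open>B2 \<subseteq> C\<close> \<open>A \<subseteq> C\<close>
      by (intro exI[of _ A1] exI[of _ A2]) (auto simp: asr_restrict_def)
  qed
  moreover have "(A1 \<union> A2, B1 \<union> B2) \<in> asr_restrict lam C"
    if "(A1, B1) \<in> asr_restrict lam C" "(A2, B2) \<in> asr_restrict lam C" for A1 B1 A2 B2
    using that un[of A1 B1 A2 B2] by (auto simp: asr_restrict_def)
  ultimately show ?thesis
    unfolding asr_space_def by simp
qed

lemma asr_bounded_subset:
  assumes "asr_space X lam" "asr_bounded X lam A" "B \<subseteq> A"
  shows "asr_bounded X lam B"
proof (cases "B = {}")
  case True
  then show ?thesis by (simp add: asr_bounded_def)
next
  case False
  with assms(2,3) obtain x where x: "x \<in> X" "(B \<union> A, {x}) \<in> lam" and "A \<subseteq> X" "A \<noteq> {}"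
    unfolding asr_bounded_def by (metis sup.absorb2 subset_empty)
  with assms(1) False obtain A1 A2 where "A1 \<noteq> {}" "A1 \<subseteq> {x}" "(B, A1) \<in> lam"
    unfolding asr_space_def by meson
  then have "(B, {x}) \<in> lam" by (metis subset_singletonD)
  then show ?thesis
    using x(1) \<open>A \<subseteq> X\<close> assms(3) by (auto simp: asr_bounded_def)
qed

lemma lsInd_le_Suc:
  "lsInd_le X lam n \<Longrightarrow> asr_space X lam \<Longrightarrow> lsInd_le X lam (n + 1)"
proof (induction rule: lsInd_le.induct)
  case (bounded X lam)
  have b: "asr_bounded X lam L" if "L \<subseteq> X" for L
    using asr_bounded_subset bounded that by blast
  have d: "asymptotically_disjoint X lam A B" if "A \<subseteq> X" "B \<subseteq> X" for A B
    using that b unfolding asymptotically_disjoint_def by blast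
  have "large_scale_separator X lam A B {}" if "A \<subseteq> X" "B \<subseteq> X" for A B
    unfolding large_scale_separator_def using that d b
    by (intro conjI exI[of _ X] exI[of _ "{}"]) auto
  moreover have "lsInd_le {} (asr_restrict lam {}) (-1)"
    by (rule lsInd_le.bounded) (simp add: asr_bounded_def)
  ultimately show ?case
    by (intro lsInd_le.step) (auto simp: asymptotically_disjoint_def)
next
  case (step n X lam)
  show ?case
  proof (rule lsInd_le.step)
    show "\<forall>A B. asymptotically_disjoint X lam A B \<longrightarrow>
      (\<exists>C. large_scale_separator X lam A B C \<and> lsInd_le C (asr_restrict lam C) (n + 1 - 1))"
    proof (intro allI impI)
      fix A B assume "asymptotically_disjoint X lam A B"
      with step obtain C where C: "large_scale_separator X lam A B C"
        and le: "asr_space C (asr_restrict lam C) \<longrightarrow> lsInd_le C (asr_restrict lam C) (n - 1 + 1)"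
        by blast
      then show "\<exists>C. large_scale_separator X lam A B C \<and>
          lsInd_le C (asr_restrict lam C) (n + 1 - 1)"
        using asr_space_restrict[OF step.prems] unfolding large_scale_separator_def by auto
    qed
  qed (use step in simp)
qed

lemma lsInd_le_mono:
  assumes "asr_space X lam" "lsInd_le X lam n" "n \<le> m"
  shows "lsInd_le X lam m"
  using assms(3,2) by (induction rule: int_ge_induct) (auto intro: lsInd_le_Suc assms(1))

lemma lsInd_le_ge: "lsInd_le X lam n \<Longrightarrow> n \<ge> -1"
  by (induction rule: lsInd_le.induct) auto

lemma lsInd_eq_Fin_iff:
  assumes "asr_space X lam"
  shows "lsInd X lam = Fin n \<longleftrightarrow> lsInd_le X lam n \<and> \<not> lsInd_le X lam (n - 1)"
proof -
  let ?P = "\<lambda>n. lsInd_le X lam n \<and> \<not> lsInd_le X lam (n - 1)"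
  have uniq: "i = j" if "?P i" "?P j" for i j
    using that lsInd_le_mono[OF assms, of i "j - 1"] lsInd_le_mono[OF assms, of j "i - 1"]
    by linarith
  have ex: "\<exists>n. ?P n" if "lsInd_le X lam m" for m
  proof (rule ccontr)
    assume no: "\<not> ?thesis"
    have "lsInd_le X lam (m - int k)" for k
    proof (induction k)
      case (Suc k)
      then show ?case using no by (metis diff_diff_eq of_nat_Suc add.commute)
    qed (use that in simp)
    from lsInd_le_ge[OF this[of "nat (m + 2)"]] lsInd_le_ge[OF that] show False
      by simp
  qed
  have the: "(THE n. ?P n) = n" if "?P n" for n
    using that uniq by (intro the_equality) auto
  show ?thesis
    unfolding lsInd_def using ex the by auto
qed

lemma lsInd_eq_Pinf_iff: "lsInd X lam = Pinf \<longleftrightarrow> (\<forall>n. \<not> lsInd_le X lam n)"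
  by (auto simp: lsInd_def)

lemma lsInd_eq_minus_one_iff:
  assumes "asr_space X lam"
  shows "lsInd X lam = Fin (-1) \<longleftrightarrow> asr_bounded X lam X"
proof -
  have "\<not> lsInd_le X lam (-1 - 1)" using lsInd_le_ge by force
  moreover have "lsInd_le X lam (-1) \<longleftrightarrow> asr_bounded X lam X"
    by (subst lsInd_le.simps) auto
  ultimately show ?thesis using lsInd_eq_Fin_iff[OF assms] by blast
qed

end

theory Submission
  imports Defs
begin

text \<open>Maps \<open>f\<close>, \<open>g\<close> witnessing an asymptotic equivalence preserve and reflect both \<open>\<lambda>\<close> and
  boundedness. Given asymptotically disjoint \<open>A, B \<subseteq> Y\<close> and a separator \<open>C\<close> between \<open>g(A)\<close> and
  \<open>g(B)\<close> in \<open>X\<close> with cover \<open>X = X\<^sub>1 \<union> X\<^sub>2\<close>, the image \<open>f(C)\<close> separates \<open>A\<close> and \<open>B\<close> with cover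
  \<open>Y = g\<^sup>-\<^sup>1(X\<^sub>1) \<union> g\<^sup>-\<^sup>1(X\<^sub>2)\<close>. Any section of \<open>f : C \<rightarrow> f(C)\<close> makes \<open>C\<close> and \<open>f(C)\<close> asymptotically
  equivalent, so induction on the dimension applies.\<close>

section \<open>Elementary rules for asymptotic disjointness\<close>

lemma asymptotically_disjointI:
  assumes "A \<subseteq> X" "B \<subseteq> X"
    and "\<And>L1 L2. L1 \<subseteq> A \<Longrightarrow> L2 \<subseteq> B \<Longrightarrow> \<not> asr_bounded X lam L1 \<Longrightarrow> \<not> asr_bounded X lam L2 \<Longrightarrow>
      (L1, L2) \<in> lam \<Longrightarrow> False"
  shows "asymptotically_disjoint X lam A B"
  unfolding asymptotically_disjoint_def
  by (intro conjI notI, fact assms(1), fact assms(2), elim exE conjE) (rule assms(3))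

lemma asymptotically_disjointD:
  assumes "asymptotically_disjoint X lam A B" "(L1, L2) \<in> lam" "L1 \<subseteq> A" "L2 \<subseteq> B"
    "\<not> asr_bounded X lam L1" "\<not> asr_bounded X lam L2"
  shows False
  using assms(1) unfolding asymptotically_disjoint_def
  by (elim conjE notE) (intro exI[of _ L1] exI[of _ L2] conjI assms(2-))

lemma asymptotically_disjoint_carrier:
  assumes "asymptotically_disjoint X lam A B"
  shows "A \<subseteq> X" "B \<subseteq> X"
  using assms unfolding asymptotically_disjoint_def by simp_all

lemma asymptotically_disjoint_subset:
  assumes "asymptotically_disjoint X lam A B" "A' \<subseteq> A"
  shows "asymptotically_disjoint X lam A' B"
proof (rule asymptotically_disjointI)
  show "A' \<subseteq> X" "B \<subseteq> X"
    using assms(2) asymptotically_disjoint_carrier[OF assms(1)] by auto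
  show False if "L1 \<subseteq> A'" "L2 \<subseteq> B" "\<not> asr_bounded X lam L1" "\<not> asr_bounded X lam L2"
    "(L1, L2) \<in> lam" for L1 L2
    by (rule asymptotically_disjointD[OF assms(1) that(5) subset_trans[OF that(1) assms(2)] that(2-4)])
qed

section \<open>Relatedness and boundedness inside one space\<close>

context
  fixes X :: "'a set" and lam
  assumes asr: "asr_space X lam"
begin

lemma asr_rel_equiv: "equiv (Pow X) lam"
  using asr unfolding asr_space_def by (rule conjunct1)

lemma asr_rel_subset: "(A, B) \<in> lam \<Longrightarrow> A \<subseteq> X \<and> B \<subseteq> X"
  using equiv_type[OF asr_rel_equiv] by blast

lemma asr_rel_refl: "A \<subseteq> X \<Longrightarrow> (A, A) \<in> lam"
  using asr_rel_equiv by (rule equivE) (simp add: refl_on_def)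

lemma asr_rel_sym: "(A, B) \<in> lam \<Longrightarrow> (B, A) \<in> lam"
  using asr_rel_equiv by (rule equivE) (rule symD)

lemma asr_rel_trans: "(A, B) \<in> lam \<Longrightarrow> (B, C) \<in> lam \<Longrightarrow> (A, C) \<in> lam"
  using asr_rel_equiv by (rule equivE) (rule transD)

text \<open>Axiom (ii) applied to \<open>A = A' \<union> A\<close>: of the two pieces into which
  \<open>B\<close> splits, the one related to \<open>A'\<close> is kept.\<close>

lemma asr_rel_nonempty_subset:
  assumes "(A, B) \<in> lam" "A' \<subseteq> A" "A' \<noteq> {}"
  obtains B' where "B' \<subseteq> B" "B' \<noteq> {}" "(A', B') \<in> lam"
proof -
  have "(A' \<union> A, B) \<in> lam" "A \<noteq> {}" using assms by (auto simp: Un_absorb1)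
  then show thesis using asr assms(3) that unfolding asr_space_def by meson
qed

text \<open>The base point moves into the set: the only nonempty subset of \<open>{x}\<close> is
  \<open>{x}\<close>, so \<open>{a}\<close> is related to \<open>{x}\<close>.\<close>

lemma asr_rel_singleton:
  assumes "(A, {x}) \<in> lam" "a \<in> A"
  shows "(A, {a}) \<in> lam"
proof -
  obtain B where "B \<subseteq> {x}" "B \<noteq> {}" "({a}, B) \<in> lam"
    using asr_rel_nonempty_subset[OF assms(1), of "{a}"] assms(2) by blast
  then have "({a}, {x}) \<in> lam" by (metis subset_singletonD)
  then show ?thesis using asr_rel_trans[OF assms(1) asr_rel_sym] by blast
qed

text \<open>Taking base points from \<open>A\<close> itself makes boundedness transportable along
  maps, whose images may miss an outside base point. The empty set is covered vacuously.\<close>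

lemma asr_bounded_iff:
  "asr_bounded X lam A \<longleftrightarrow> A \<subseteq> X \<and> (\<forall>a\<in>A. (A, {a}) \<in> lam)"
proof
  assume "asr_bounded X lam A"
  then show "A \<subseteq> X \<and> (\<forall>a\<in>A. (A, {a}) \<in> lam)"
    using asr_rel_singleton unfolding asr_bounded_def by blast
next
  assume "A \<subseteq> X \<and> (\<forall>a\<in>A. (A, {a}) \<in> lam)"
  then show "asr_bounded X lam A" unfolding asr_bounded_def by blast
qed

lemma asr_bounded_rel:
  assumes "asr_bounded X lam A" "(A, B) \<in> lam"
  shows "asr_bounded X lam B"
proof (cases "B = {}")
  case True
  then show ?thesis by (simp add: asr_bounded_def)
next
  case False
  \<comment> \<open>A nonempty \<open>B\<close> would have a nonempty partner inside
    \<open>A\<close>.\<close>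
  then have "A \<noteq> {}"
    using asr_rel_nonempty_subset[OF asr_rel_sym[OF assms(2)], of B] by blast
  then obtain x where "x \<in> X" "(A, {x}) \<in> lam"
    using assms(1) by (auto simp: asr_bounded_def)
  then show ?thesis
    using asr_rel_subset[OF assms(2)] asr_rel_trans[OF asr_rel_sym[OF assms(2)]]
    unfolding asr_bounded_def by blast
qed

text \<open>A nonempty part of \<open>A'\<close> has a related partner in \<open>A\<close>, which
  inherits its unboundedness. This lets a separator \<open>C\<close> be replaced by \<open>g\<close>
  f \<open>C\<close>.\<close>

lemma asymptotically_disjoint_rel:
  assumes "asymptotically_disjoint X lam A B" "(A, A') \<in> lam"
  shows "asymptotically_disjoint X lam A' B"
proof (rule asymptotically_disjointI)
  show "A' \<subseteq> X" using asr_rel_subset[OF assms(2)] by blast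
  show "B \<subseteq> X" by (rule asymptotically_disjoint_carrier[OF assms(1)])
  fix L1 L2
  assume L: "L1 \<subseteq> A'" "L2 \<subseteq> B" "\<not> asr_bounded X lam L1" "\<not> asr_bounded X lam L2"
    "(L1, L2) \<in> lam"
  have "L1 \<noteq> {}" using L(3) by (auto simp: asr_bounded_def)
  then obtain L where L': "L \<subseteq> A" "(L1, L) \<in> lam"
    using asr_rel_nonempty_subset[OF asr_rel_sym[OF assms(2)] L(1)] by blast
  show False
  proof (rule asymptotically_disjointD[OF assms(1) _ L'(1) L(2) _ L(4)])
    show "\<not> asr_bounded X lam L"
      using L(3) asr_bounded_rel[OF _ asr_rel_sym[OF L'(2)]] by blast
    show "(L, L2) \<in> lam"
      by (rule asr_rel_trans[OF asr_rel_sym[OF L'(2)] L(5)])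
  qed
qed

end

section \<open>Transport along an asymptotic equivalence\<close>

text \<open>Properness of \<open>f\<close> and \<open>g\<close> is not assumed: it follows from the other conditions, since
  \<open>f\<close> reflects \<open>\<lambda>\<close>.\<close>

locale asr_equivalence =
  fixes X :: "'a set" and lam and Y :: "'b set" and lam' and f g
  assumes asr_X: "asr_space X lam" and asr_Y: "asr_space Y lam'"
    and f_in: "f \<in> X \<rightarrow> Y" and g_in: "g \<in> Y \<rightarrow> X"
    and f_rel: "(A, B) \<in> lam \<Longrightarrow> (f ` A, f ` B) \<in> lam'"
    and g_rel: "(A', B') \<in> lam' \<Longrightarrow> (g ` A', g ` B') \<in> lam"
    and gf_rel: "A \<subseteq> X \<Longrightarrow> (g ` f ` A, A) \<in> lam"
    and fg_rel: "A' \<subseteq> Y \<Longrightarrow> (f ` g ` A', A') \<in> lam'"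
begin

lemma flip: "asr_equivalence Y lam' X lam g f"
  by unfold_locales (fact asr_X asr_Y f_in g_in f_rel g_rel gf_rel fg_rel)+

lemma image_subset: "A \<subseteq> X \<Longrightarrow> f ` A \<subseteq> Y"
  using f_in by blast

text \<open>For reflection, apply \<open>g\<close> and use that \<open>g\<close> f \<open>A\<close>
  is related to \<open>A\<close>, and likewise for \<open>B\<close>.\<close>

lemma rel_image_iff:
  assumes "A \<subseteq> X" "B \<subseteq> X"
  shows "(f ` A, f ` B) \<in> lam' \<longleftrightarrow> (A, B) \<in> lam"
proof
  assume "(f ` A, f ` B) \<in> lam'"
  then have "(g ` f ` A, g ` f ` B) \<in> lam" by (rule g_rel)
  then have "(A, g ` f ` B) \<in> lam"
    by (rule asr_rel_trans[OF asr_X asr_rel_sym[OF asr_X gf_rel[OF assms(1)]]])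
  then show "(A, B) \<in> lam"
    by (rule asr_rel_trans[OF asr_X _ gf_rel[OF assms(2)]])
qed (rule f_rel)

lemma bounded_image_iff:
  assumes "A \<subseteq> X"
  shows "asr_bounded Y lam' (f ` A) \<longleftrightarrow> asr_bounded X lam A"
proof -
  have "(f ` A, {f a}) \<in> lam' \<longleftrightarrow> (A, {a}) \<in> lam" if "a \<in> A" for a
    using rel_image_iff[of A "{a}"] assms that by auto
  then show ?thesis
    using assms image_subset by (simp add: asr_bounded_iff[OF asr_X] asr_bounded_iff[OF asr_Y])
qed

lemma asymptotically_disjoint_image_iff:
  assumes "A \<subseteq> X" "B \<subseteq> X"
  shows "asymptotically_disjoint Y lam' (f ` A) (f ` B) \<longleftrightarrow> asymptotically_disjoint X lam A B"
proof
  assume *: "asymptotically_disjoint Y lam' (f ` A) (f ` B)"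
  show "asymptotically_disjoint X lam A B"
  proof (rule asymptotically_disjointI[OF assms])
    fix L1 L2
    assume L: "L1 \<subseteq> A" "L2 \<subseteq> B" "\<not> asr_bounded X lam L1" "\<not> asr_bounded X lam L2"
      "(L1, L2) \<in> lam"
    then have "L1 \<subseteq> X" "L2 \<subseteq> X" using assms by auto
    then show False
      using asymptotically_disjointD[OF * f_rel[OF L(5)]] L by (simp add: bounded_image_iff image_mono)
  qed
next
  assume *: "asymptotically_disjoint X lam A B"
  show "asymptotically_disjoint Y lam' (f ` A) (f ` B)"
  proof (rule asymptotically_disjointI)
    fix L1 L2
    assume L: "L1 \<subseteq> f ` A" "L2 \<subseteq> f ` B" "\<not> asr_bounded Y lam' L1"
      "\<not> asr_bounded Y lam' L2" "(L1, L2) \<in> lam'"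
    obtain M1 M2 where M: "L1 = f ` M1" "M1 \<subseteq> A" "L2 = f ` M2" "M2 \<subseteq> B"
      using L(1,2) by (meson subset_imageE)
    then have "M1 \<subseteq> X" "M2 \<subseteq> X" using assms by auto
    then show False
      using asymptotically_disjointD[OF * _ M(2,4)] L M(1,3)
      by (simp add: bounded_image_iff rel_image_iff)
  qed (use assms image_subset in blast)+
qed

lemma large_scale_separator_image:
  assumes sep: "large_scale_separator X lam (g ` A) (g ` B) C" and AB: "A \<subseteq> Y" "B \<subseteq> Y"
  shows "large_scale_separator Y lam' A B (f ` C)"
proof -
  interpret inv: asr_equivalence Y lam' X lam g f by (rule flip)
  obtain X1 X2 where C: "C \<subseteq> X" "asymptotically_disjoint X lam C (g ` A)"
      "asymptotically_disjoint X lam C (g ` B)"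
    and X12: "X = X1 \<union> X2" "asymptotically_disjoint X lam X1 (g ` A)"
      "asymptotically_disjoint X lam X2 (g ` B)"
    and LC: "\<And>L1 L2. L1 \<subseteq> X1 \<Longrightarrow> L2 \<subseteq> X2 \<Longrightarrow> \<not> asr_bounded X lam L1 \<Longrightarrow>
      \<not> asr_bounded X lam L2 \<Longrightarrow> (L1, L2) \<in> lam \<Longrightarrow> \<exists>L\<subseteq>C. (L, L1) \<in> lam"
    using sep unfolding large_scale_separator_def by blast
  define Y1 Y2 where "Y1 = g -` X1 \<inter> Y" and "Y2 = g -` X2 \<inter> Y"
  have Y12: "Y = Y1 \<union> Y2" "Y1 \<subseteq> Y" "Y2 \<subseteq> Y" "g ` Y1 \<subseteq> X1" "g ` Y2 \<subseteq> X2"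
    using g_in X12(1) by (auto simp: Y1_def Y2_def)
  have "(C, g ` f ` C) \<in> lam" by (rule asr_rel_sym[OF asr_X gf_rel[OF C(1)]])
  then have disj_C: "asymptotically_disjoint Y lam' (f ` C) D"
    if "asymptotically_disjoint X lam C (g ` D)" "D \<subseteq> Y" for D
    using asymptotically_disjoint_rel[OF asr_X that(1)] that(2)
      inv.asymptotically_disjoint_image_iff[OF image_subset[OF C(1)] that(2)] by blast
  have disj_Y: "asymptotically_disjoint Y lam' Z D"
    if "asymptotically_disjoint X lam W (g ` D)" "g ` Z \<subseteq> W" "Z \<subseteq> Y" "D \<subseteq> Y" for W Z D
    using asymptotically_disjoint_subset[OF that(1,2)] that(3,4)
    by (simp add: inv.asymptotically_disjoint_image_iff)
  have sep': "\<exists>L\<subseteq>f ` C. (L, L1) \<in> lam'"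
    if L: "L1 \<subseteq> Y1" "L2 \<subseteq> Y2" "\<not> asr_bounded Y lam' L1" "\<not> asr_bounded Y lam' L2"
      "(L1, L2) \<in> lam'" for L1 L2
  proof -
    have LY: "L1 \<subseteq> Y" "L2 \<subseteq> Y" using L(1,2) Y12(2,3) by blast+
    have gL: "g ` L1 \<subseteq> X1" "g ` L2 \<subseteq> X2" using L(1,2) Y12(4,5) by blast+
    have gL': "\<not> asr_bounded X lam (g ` L1)" "\<not> asr_bounded X lam (g ` L2)"
      using L(3,4) LY by (simp_all add: inv.bounded_image_iff)
    \<comment> \<open>The image \<open>f\<close> L\<open>lies in\<close>f \<open>C\<close> and is
      related to \<open>f\<close> g \<open>L1\<close>, hence to \<open>L1\<close>.\<close>
    obtain L where "L \<subseteq> C" "(L, g ` L1) \<in> lam"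
      using LC[OF gL gL' g_rel[OF L(5)]] by blast
    then show ?thesis
      using asr_rel_trans[OF asr_Y f_rel fg_rel[OF LY(1)]] by (intro exI[of _ "f ` L"]) auto
  qed
  show ?thesis
    unfolding large_scale_separator_def
    by (intro conjI image_subset[OF C(1)] disj_C[OF C(2) AB(1)] disj_C[OF C(3) AB(2)],
        rule exI[of _ Y1], rule exI[of _ Y2],
        intro conjI allI impI Y12(1) disj_Y[OF X12(2) Y12(4,2) AB(1)]
          disj_Y[OF X12(3) Y12(5,3) AB(2)])
      (rule sep')
qed

lemma asr_equivalence_restrict:
  assumes C: "C \<subseteq> X"
  shows "asr_equivalence C (asr_restrict lam C) (f ` C) (asr_restrict lam' (f ` C))
    f (inv_into C f)"
proof -
  define h where "h = inv_into C f"
  have h: "h y \<in> C" "f (h y) = y" if "y \<in> f ` C" for y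
    using that by (simp_all add: h_def inv_into_into f_inv_into_f)
  have h_in: "h ` D \<subseteq> C" and fh: "f ` h ` D = D" if "D \<subseteq> f ` C" for D
  proof -
    show "h ` D \<subseteq> C" using that h(1) by blast
    have "(\<lambda>y. f (h y)) ` D = (\<lambda>y. y) ` D" using that h(2) by (intro image_cong) auto
    then show "f ` h ` D = D" by (simp add: image_image)
  qed
  have h_rel: "(h ` D, h ` E) \<in> lam" if "(D, E) \<in> lam'" "D \<subseteq> f ` C" "E \<subseteq> f ` C" for D E
    using rel_image_iff[of "h ` D" "h ` E"] h_in[OF that(2)] h_in[OF that(3)] C that fh by simp
  \<comment> \<open>\<open>h\<close> need not undo \<open>f\<close>, but \<open>h\<close> f
    \<open>A\<close> and \<open>A\<close> have the same image under \<open>f\<close>, so reflection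
    relates them.\<close>
  have hf: "(h ` f ` A, A) \<in> lam" if "A \<subseteq> C" for A
  proof -
    have fA: "f ` A \<subseteq> f ` C" using that by auto
    have A: "A \<subseteq> X" using that C by blast
    have "h ` f ` A \<subseteq> X" using h_in[OF fA] C by (rule subset_trans)
    moreover have "(f ` h ` f ` A, f ` A) \<in> lam'"
      using asr_rel_refl[OF asr_Y image_subset[OF A]] by (simp only: fh[OF fA])
    ultimately show ?thesis
      using rel_image_iff A by blast
  qed
  show ?thesis
    unfolding h_def[symmetric]
  proof
    show "asr_space C (asr_restrict lam C)"
      by (rule asr_space_restrict[OF asr_X C])
    show "asr_space (f ` C) (asr_restrict lam' (f ` C))"
      by (rule asr_space_restrict[OF asr_Y image_subset[OF C]])
    show "h \<in> f ` C \<rightarrow> C" using h_in by blast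
    show "(f ` A, f ` B) \<in> asr_restrict lam' (f ` C)" if "(A, B) \<in> asr_restrict lam C" for A B
      using that f_rel by (auto simp: asr_restrict_def)
    show "(h ` A, h ` B) \<in> asr_restrict lam C" if "(A, B) \<in> asr_restrict lam' (f ` C)" for A B
      using that h_rel h_in unfolding asr_restrict_def by blast
    show "(h ` f ` A, A) \<in> asr_restrict lam C" if "A \<subseteq> C" for A
      using that hf h_in[OF image_mono[OF that]] by (simp add: asr_restrict_def)
    show "(f ` h ` B, B) \<in> asr_restrict lam' (f ` C)" if "B \<subseteq> f ` C" for B
      using that fh[OF that] asr_rel_refl[OF asr_Y] image_subset[OF C]
      by (auto simp: asr_restrict_def)
  qed auto
qed

end

section \<open>Induction on the dimension\<close>

lemma lsInd_le_equivalence: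
  fixes X :: "'a set" and Y :: "'b set" and f :: "'a \<Rightarrow> 'b"
  assumes "lsInd_le X lam n" "asr_equivalence X lam Y lam' f g"
  shows "lsInd_le Y lam' n"
  using assms
proof (induction arbitrary: Y lam' f g rule: lsInd_le.induct)
  case (bounded X lam)
  interpret inv: asr_equivalence Y lam' X lam g f
    using bounded.prems by (rule asr_equivalence.flip)
  have "asr_bounded X lam (g ` Y)"
    using asr_bounded_subset[OF inv.asr_Y bounded.hyps] inv.image_subset by blast
  then show ?case using inv.bounded_image_iff by (intro lsInd_le.bounded) blast
next
  case (step n X lam)
  interpret asr_equivalence X lam Y lam' f g by (rule step.prems)
  interpret inv: asr_equivalence Y lam' X lam g f by (rule flip)
  have "\<exists>C. large_scale_separator Y lam' A B C \<and> lsInd_le C (asr_restrict lam' C) (n - 1)"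
    if AB: "asymptotically_disjoint Y lam' A B" for A B
  proof -
    have Y: "A \<subseteq> Y" "B \<subseteq> Y" using asymptotically_disjoint_carrier[OF AB] .
    then have "asymptotically_disjoint X lam (g ` A) (g ` B)"
      using AB inv.asymptotically_disjoint_image_iff by blast
    then obtain C where C: "large_scale_separator X lam (g ` A) (g ` B) C"
      and IH: "\<And>(Y :: 'b set) lam' f g. asr_equivalence C (asr_restrict lam C) Y lam' f g \<Longrightarrow>
        lsInd_le Y lam' (n - 1)"
      using step.IH by blast
    have "C \<subseteq> X" using C by (simp add: large_scale_separator_def)
    then show ?thesis
      using large_scale_separator_image[OF C Y] IH[OF asr_equivalence_restrict] by blast
  qed
  then show ?case using step.hyps by (intro lsInd_le.step) blast+
qed

theorem theorem3p6:
  fixes X :: "'a set" and lam :: "('a set \<times> 'a set) set"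
    and Y :: "'b set" and lam' :: "('b set \<times> 'b set) set"
  assumes "asr_space X lam"
    and "asr_space Y lam'"
    and "asymptotically_equivalent X lam Y lam'"
  shows "lsInd X lam = lsInd Y lam'"
proof -
  obtain f g where fg: "asr_mapping X lam Y lam' f" "asr_mapping Y lam' X lam g"
    "\<forall>A. A \<subseteq> X \<longrightarrow> (g ` f ` A, A) \<in> lam" "\<forall>B. B \<subseteq> Y \<longrightarrow> (f ` g ` B, B) \<in> lam'"
    using assms(3) unfolding asymptotically_equivalent_def by blast
  have "asr_equivalence X lam Y lam' f g"
  proof
    show "(f ` A, f ` B) \<in> lam'" if "(A, B) \<in> lam" for A B
      using fg(1) that asr_rel_subset[OF assms(1) that] by (auto simp: asr_mapping_def)
    show "(g ` A, g ` B) \<in> lam" if "(A, B) \<in> lam'" for A B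
      using fg(2) that asr_rel_subset[OF assms(2) that] by (auto simp: asr_mapping_def)
  qed (use assms(1,2) fg in \<open>auto simp: asr_mapping_def\<close>)
  then have "lsInd_le X lam n \<longleftrightarrow> lsInd_le Y lam' n" for n
    using lsInd_le_equivalence asr_equivalence.flip by metis
  \<comment> \<open>\<open>lsInd\<close> depends only on which \<open>n\<close> satisfy
    \<open>lsInd_le\<close>, so finite and infinite values are settled together.\<close>
  then show ?thesis unfolding lsInd_def by presburger
qed

end
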